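(* Let $G$ be a graph of order $n \geq 2$, and let $\overline{G}$ be its complement. Then $$4 \leq b_{\rm g}'(G) + b_{\rm g}'(\overline{G}) \leq n+2.$$
   Context: All graphs are finite, simple and undirected; the order of a graph is its number of vertices. The burning game on a graph $G$ is played by two players, Burner and Staller, in rounds $t=1,2,3,\dots$. Initially (round $0$) all vertices are unburned. Each round $t\ge 1$ consists of two phases: first, in the spreading phase, every unburned vertex having a burning neighbor starts to burn (fire spreads simultaneously, by distance one, from all burning vertices); then, in the selection phase, if unburned vertices remain, the player whose turn it is chooses one unburned vertex, which starts to burn. Burning vertices stay burning forever. The players alternate: one of them selects in the odd rounds, the other in the even rounds. The game ends in the first round in which all vertices of $G$ are burning (possibly already after the spreading phase of that round). Burner wants to minimize the number of rounds and Staller wants to maximize it. If both play optimally, the number of rounds is denoted $b_{\rm g}'(G)$ (the Staller-start game burning number) when Staller makes the first move (selects in round 1). *)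

theory Defs
  imports "Graph_Theory.Pair_Digraph"
begin

text \<open>
  A finite simple undirected graph is a \<^locale>\<open>pair_graph\<close>: finitely many vertices and arcs,
  no loops, and a symmetric arc relation, so that the edge between u and v is the
  pair of arcs (u, v), (v, u).
\<close>

definition complement :: "'a pair_pre_digraph \<Rightarrow> 'a pair_pre_digraph" where
  "complement G =
     \<lparr> pverts = pverts G,
       parcs = {(u, v). u \<in> pverts G \<and> v \<in> pverts G \<and> u \<noteq> v \<and> (u, v) \<notin> parcs G} \<rparr>"

lemma (in pair_graph) pair_graph_complement: "pair_graph (complement G)"
proof
  show "finite (parcs (complement G))"
    by (rule finite_subset[of _ "pverts G \<times> pverts G"])
      (auto simp: complement_def pair_finite_verts)
  have "(u, v) \<in> parcs G \<longleftrightarrow> (v, u) \<in> parcs G" for u v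
    using pair_sym_arcs by (auto simp: symmetric_def sym_def)
  then show "symmetric (with_proj (complement G))"
    by (auto simp: complement_def symmetric_def sym_def)
qed (auto simp: complement_def pair_finite_verts)

datatype player = Burner | Staller

fun opponent :: "player \<Rightarrow> player" where
  "opponent Burner = Staller"
| "opponent Staller = Burner"

definition spread :: "'a pair_pre_digraph \<Rightarrow> 'a set \<Rightarrow> 'a set" where
  "spread G B = B \<union> {v \<in> pverts G. \<exists>u\<in>B. (u, v) \<in> parcs G}"

text \<open>
  \<open>rounds_left G p B\<close> is the number of further rounds under optimal play when exactly the
  vertices in \<open>B\<close> burn at the end of a round and player \<open>p\<close> is the one to select in the next
  round. It is the minimax value of the game. The value for infinite vertex sets is a dummy
  that makes the recursion well-founded. In the last case the set of selectable vertices
  is finite and nonempty, so \<^const>\<open>Min\<close> and \<^const>\<open>Max\<close> are meaningful.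
\<close>

function rounds_left :: "'a pair_pre_digraph \<Rightarrow> player \<Rightarrow> 'a set \<Rightarrow> nat" where
  "rounds_left G p B =
     (if infinite (pverts G) \<or> pverts G \<subseteq> B then 0
      else if pverts G \<subseteq> spread G B then 1
      else 1 + (case p of Burner \<Rightarrow> Min | Staller \<Rightarrow> Max)
                 ((\<lambda>v. rounds_left G (opponent p) (insert v (spread G B)))
                    ` (pverts G - spread G B)))"
  by pat_completeness auto
termination
proof (relation "measure (\<lambda>(G, p, B). card (pverts G - B))", goal_cases)
  case (2 G p B v)
  then have "pverts G - insert v (spread G B) \<subset> pverts G - B"
    by (auto simp: spread_def)
  with 2 show ?case
    by (simp add: psubset_card_mono del: card_Diff_insert)
qed simp

declare rounds_left.simps [simp del]

definition staller_start_burning_number :: "'a pair_pre_digraph \<Rightarrow> nat" where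
  "staller_start_burning_number G = rounds_left G Staller {}"

end

theory Submission
  imports Defs
begin

text \<open>
  In a connected graph on \<open>n\<close> vertices every round after the first burns at least two new
  vertices, one by spreading and one by selection, so the game lasts at most
  \<open>1 + n div 2\<close> rounds; if \<open>G\<close> and its complement are both connected, adding the two
  bounds suffices. If \<open>G\<close> is disconnected, its complement has diameter at most 2, so
  the game on the complement lasts at most 3 rounds. If it lasts at most 2 rounds, the trivial
  bound \<open>n\<close> for \<open>G\<close> suffices. Otherwise \<open>n \<ge> 4\<close> and \<open>G\<close> has an edge, and Burner gains one round
  on \<open>G\<close> by making the fire spread along an edge in round 2 or 3.
\<close>

section \<open>Spreading and general bounds on the game value\<close>

lemma spread_mono: "A \<subseteq> B \<Longrightarrow> spread G A \<subseteq> spread G B"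
  by (auto simp: spread_def)

lemma subset_spread: "B \<subseteq> spread G B"
  by (auto simp: spread_def)

lemma spread_subset: "B \<subseteq> pverts G \<Longrightarrow> spread G B \<subseteq> pverts G"
  by (auto simp: spread_def)

lemma spread_empty [simp]: "spread G {} = {}"
  by (auto simp: spread_def)

text \<open>A bound common to all moves bounds their minimum as well as their maximum, so it does
  not matter who selects. A round that ends by spreading costs only 1.\<close>

lemma rounds_left_le_SucI:
  assumes "\<And>v. v \<in> pverts G - spread G B \<Longrightarrow>
             rounds_left G (opponent p) (insert v (spread G B)) \<le> k"
  shows "rounds_left G p B \<le> Suc k"
proof (cases "infinite (pverts G) \<or> pverts G \<subseteq> spread G B")
  case True
  then show ?thesis
    by (subst rounds_left.simps) auto
next
  case False
  then have "\<not> pverts G \<subseteq> B" and fin: "finite (pverts G - spread G B)"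
      and ne: "pverts G - spread G B \<noteq> {}"
    using subset_spread[of B G] by auto
  obtain v where v: "v \<in> pverts G - spread G B"
    using ne by blast
  show ?thesis
  proof (cases p)
    case Burner
    then have "rounds_left G p B = 1 + Min ((\<lambda>v. rounds_left G (opponent p)
        (insert v (spread G B))) ` (pverts G - spread G B))"
      using False \<open>\<not> pverts G \<subseteq> B\<close> by (subst rounds_left.simps) auto
    moreover have "Min ((\<lambda>v. rounds_left G (opponent p)
        (insert v (spread G B))) ` (pverts G - spread G B)) \<le> k"
      using fin v assms[OF v] by (subst Min_le_iff) auto
    ultimately show ?thesis by simp
  next
    case Staller
    then have "rounds_left G p B = 1 + Max ((\<lambda>v. rounds_left G (opponent p)
        (insert v (spread G B))) ` (pverts G - spread G B))"
      using False \<open>\<not> pverts G \<subseteq> B\<close> by (subst rounds_left.simps) auto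
    moreover have "Max ((\<lambda>v. rounds_left G (opponent p)
        (insert v (spread G B))) ` (pverts G - spread G B)) \<le> k"
      using fin ne assms by (subst Max_le_iff) auto
    ultimately show ?thesis by simp
  qed
qed

text \<open>One good move bounds the minimum; this is how an explicit Burner strategy
  enters.\<close>

lemma rounds_left_Burner_le:
  assumes "v \<in> pverts G - spread G B"
    and "rounds_left G Staller (insert v (spread G B)) \<le> k"
  shows "rounds_left G Burner B \<le> Suc k"
proof (cases "infinite (pverts G)")
  case True
  then show ?thesis
    by (subst rounds_left.simps) auto
next
  case False
  then have fin: "finite (pverts G - spread G B)"
    by simp
  have "\<not> pverts G \<subseteq> spread G B" "\<not> pverts G \<subseteq> B"
    using assms(1) subset_spread[of B G] by auto
  then have "rounds_left G Burner B = 1 + Min ((\<lambda>v. rounds_left G Staller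
      (insert v (spread G B))) ` (pverts G - spread G B))"
    using False by (subst rounds_left.simps) auto
  moreover have "Min ((\<lambda>v. rounds_left G Staller
      (insert v (spread G B))) ` (pverts G - spread G B)) \<le> k"
    using fin assms by (subst Min_le_iff) auto
  ultimately show ?thesis by simp
qed

lemma rounds_left_eq_0: "pverts G \<subseteq> B \<Longrightarrow> rounds_left G p B = 0"
  by (subst rounds_left.simps) simp

lemma rounds_left_le_1: "pverts G \<subseteq> spread G B \<Longrightarrow> rounds_left G p B \<le> 1"
  by (subst rounds_left.simps) simp

text \<open>Whatever is selected next, all of \<open>spread G B\<close> burns by then, so the
  following spreading phase ends the game at the latest.\<close>

lemma rounds_left_le_2:
  assumes "pverts G \<subseteq> spread G (spread G B)"
  shows "rounds_left G p B \<le> 2"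
  using rounds_left_le_SucI[of G B p 1]
    rounds_left_le_1[of G "insert _ (spread G B)"]
    assms spread_mono[of "spread G B" "insert _ (spread G B)" G]
  by (metis One_nat_def Suc_1 subset_insertI subset_trans)

text \<open>Each round burns at least one new vertex, by spreading or by selection.\<close>

lemma rounds_left_le_card:
  assumes "finite (pverts G)"
  shows "rounds_left G p B \<le> card (pverts G - B)"
  using assms
proof (induction G p B rule: rounds_left.induct)
  case (1 G p B)
  show ?case
  proof (cases "pverts G \<subseteq> B")
    case True
    then show ?thesis by (simp add: rounds_left_eq_0)
  next
    case False
    then have pos: "card (pverts G - B) > 0"
      using 1(2) by (simp add: card_gt_0_iff)
    have "rounds_left G p B \<le> Suc (card (pverts G - B) - 1)"
    proof (rule rounds_left_le_SucI)
      fix v assume v: "v \<in> pverts G - spread G B"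
      have "rounds_left G (opponent p) (insert v (spread G B))
          \<le> card (pverts G - insert v (spread G B))"
        using 1 False v by blast
      also have "\<dots> \<le> card (pverts G - B - {v})"
        using 1(2) subset_spread[of B G] by (intro card_mono) auto
      also have "\<dots> = card (pverts G - B) - 1"
        using v subset_spread[of B G] by (intro card_Diff_singleton) auto
      finally show "rounds_left G (opponent p) (insert v (spread G B)) \<le> card (pverts G - B) - 1" .
    qed
    then show ?thesis using pos by simp
  qed
qed

text \<open>Vertices caught by the coming spreading phase cost no extra round, so only the survivors
  are counted. The \<open>max 1\<close> covers the round that spreading alone completes.\<close>

lemma rounds_left_le_card_spread:
  assumes "finite (pverts G)"
  shows "rounds_left G p B \<le> max 1 (card (pverts G - spread G B))"
proof (cases "pverts G \<subseteq> spread G B")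
  case True
  then show ?thesis using rounds_left_le_1[of G B p] by simp
next
  case False
  then have pos: "card (pverts G - spread G B) > 0"
    using assms by (simp add: card_gt_0_iff)
  have "rounds_left G p B \<le> Suc (card (pverts G - spread G B) - 1)"
  proof (rule rounds_left_le_SucI)
    fix v assume v: "v \<in> pverts G - spread G B"
    have "pverts G - insert v (spread G B) = pverts G - spread G B - {v}"
      by auto
    then show "rounds_left G (opponent p) (insert v (spread G B))
        \<le> card (pverts G - spread G B) - 1"
      using rounds_left_le_card[OF assms, of "opponent p" "insert v (spread G B)"] v
      by (simp add: card_Diff_singleton)
  qed
  then show ?thesis using pos by simp
qed

section \<open>The Staller-start value, and its bound for connected graphs\<close>

lemma staller_start_le_SucI:
  assumes "\<And>v. v \<in> pverts G \<Longrightarrow> rounds_left G Burner {v} \<le> k"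
  shows "staller_start_burning_number G \<le> Suc k"
  unfolding staller_start_burning_number_def
  by (rule rounds_left_le_SucI) (use assms in simp)

text \<open>Nothing spreads in round 1, so it burns a single vertex and leaves another for round
  2.\<close>

lemma two_le_staller_start:
  assumes "card (pverts G) \<ge> 2"
  shows "2 \<le> staller_start_burning_number G"
proof -
  have fin: "finite (pverts G)"
    using assms card.infinite by fastforce
  then obtain v where v: "v \<in> pverts G"
    using assms by fastforce
  have "\<not> pverts G \<subseteq> {v}"
    using assms card_mono[of "{v}" "pverts G"] by auto
  then have "1 \<le> rounds_left G Burner {v}"
    using fin by (subst rounds_left.simps) auto
  also have "\<dots> \<le> Max ((\<lambda>v. rounds_left G Burner {v}) ` pverts G)"
    using fin v by (intro Max_ge) auto
  finally show ?thesis
    using fin v unfolding staller_start_burning_number_def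
    by (subst rounds_left.simps) auto
qed

text \<open>For symmetric arcs this is connectedness (vacuous for the empty graph), as the sets
  fixed by \<open>spread\<close> are the unions of components. This form yields a new burning vertex
  in each spreading phase, and its negation yields a cut without edges.\<close>

definition spread_connected :: "'a pair_pre_digraph \<Rightarrow> bool" where
  "spread_connected G \<longleftrightarrow>
     (\<forall>B. B \<subseteq> pverts G \<and> B \<noteq> {} \<and> spread G B = B \<longrightarrow> B = pverts G)"

text \<open>Rounds burn vertices at least in pairs; the bound rounds up because the last round may
  burn only one.\<close>

lemma rounds_left_spread_connected:
  assumes "finite (pverts G)" "spread_connected G" "B \<subseteq> pverts G" "B \<noteq> {}"
  shows "rounds_left G p B \<le> (card (pverts G - B) + 1) div 2"
  using assms
proof (induction G p B rule: rounds_left.induct)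
  case (1 G p B)
  let ?S = "spread G B"
  show ?case
  proof (cases "pverts G \<subseteq> B")
    case True
    then show ?thesis by (simp add: rounds_left_eq_0)
  next
    case False
    then have pos: "card (pverts G - B) > 0"
      using 1(2) by (simp add: card_gt_0_iff)
    have "rounds_left G p B \<le> Suc ((card (pverts G - B) - 1) div 2)"
    proof (rule rounds_left_le_SucI)
      fix v assume v: "v \<in> pverts G - ?S"
      \<comment> \<open>\<open>B\<close> is nonempty and proper, hence not closed under spreading.
        The pair consists of \<open>w\<close>, gained by spreading, and \<open>v\<close>, gained by
        selection.\<close>
      have "?S \<noteq> B"
        using 1(3-5) False unfolding spread_connected_def by blast
      then obtain w where w: "w \<in> ?S" "w \<notin> B"
        using subset_spread[of B G] by blast
      have sub: "?S \<subseteq> pverts G"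
        using 1(4) by (rule spread_subset)
      have "card (pverts G - insert v ?S) \<le> card (pverts G - B - {v, w})"
        using 1(2) subset_spread[of B G] w by (intro card_mono) auto
      also have "\<dots> = card (pverts G - B) - card {v, w}"
        using v w sub subset_spread[of B G] by (intro card_Diff_subset) auto
      also have two: "card {v, w} = 2"
        using v w by (cases "v = w") auto
      finally have "(card (pverts G - insert v ?S) + 1) div 2 \<le> (card (pverts G - B) - 2 + 1) div 2"
        by (intro div_le_mono) simp
      \<comment> \<open>At least two vertices are unburned, so the subtraction of 2 above is
        exact.\<close>
      moreover have "card {v, w} \<le> card (pverts G - B)"
        using 1(2) v w sub subset_spread[of B G] by (intro card_mono) auto
      moreover have "rounds_left G (opponent p) (insert v ?S)
          \<le> (card (pverts G - insert v ?S) + 1) div 2"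
        using 1 False v sub by blast
      ultimately show "rounds_left G (opponent p) (insert v ?S) \<le> (card (pverts G - B) - 1) div 2"
        using two by linarith
    qed
    then show ?thesis using pos by linarith
  qed
qed

lemma staller_start_le_spread_connected:
  assumes "finite (pverts G)" "spread_connected G"
  shows "staller_start_burning_number G \<le> Suc (card (pverts G) div 2)"
proof (rule staller_start_le_SucI)
  fix v assume v: "v \<in> pverts G"
  then have "card (pverts G) > 0"
    using assms(1) by (auto simp: card_gt_0_iff)
  \<comment> \<open>After round 1 one vertex fewer is unburned, and this cancels the
    \<open>+ 1\<close> of the rounding.\<close>
  then show "rounds_left G Burner {v} \<le> card (pverts G) div 2"
    using rounds_left_spread_connected[OF assms, of "{v}" Burner] v
    by (simp add: card_Diff_singleton)
qed

section \<open>Complements of disconnected graphs\<close>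

lemma pverts_complement [simp]: "pverts (complement G) = pverts G"
  by (simp add: complement_def)

lemma (in pair_graph) complement_complement: "complement (complement G) = G"
proof (rule pair_pre_digraph.equality)
  show "parcs (complement (complement G)) = parcs G"
    using in_arcsD1 in_arcsD2 no_loops
    by (fastforce simp: complement_def)
qed (simp_all add: complement_def)

text \<open>The complement contains every edge across an edgeless cut of \<open>G\<close>. Vertices
  on opposite sides are thus adjacent, and those on the same side have a common neighbor on the
  other side (\<open>b\<close> or \<open>c\<close>).\<close>

lemma (in pair_graph) spread_spread_complement:
  assumes "\<not> spread_connected G" "v \<in> pverts G"
  shows "pverts G \<subseteq> spread (complement G) (spread (complement G) {v})"
proof -
  obtain B where B: "B \<subseteq> pverts G" "B \<noteq> {}" "spread G B = B" "B \<noteq> pverts G"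
    using assms(1) unfolding spread_connected_def by blast
  have cross: "(x, y) \<in> parcs (complement G) \<and> (y, x) \<in> parcs (complement G)"
    if "x \<in> B" "y \<in> pverts G - B" for x y
  proof -
    have "(x, y) \<notin> parcs G"
      using B(3) that unfolding spread_def by blast
    moreover from this have "(y, x) \<notin> parcs G"
      using pair_sym_arcs by (auto simp: symmetric_def sym_def)
    ultimately show ?thesis
      using B(1) that by (auto simp: complement_def)
  qed
  obtain b c where b: "b \<in> B" and c: "c \<in> pverts G - B"
    using B by blast
  show ?thesis
  proof
    fix x assume "x \<in> pverts G"
    then show "x \<in> spread (complement G) (spread (complement G) {v})"
      using cross b c B(1) assms(2) unfolding spread_def
      by (cases "v \<in> B"; cases "x \<in> B") auto
  qed
qed

section \<open>Saving a round along an edge, and the disconnected case\<close>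

lemma staller_start_le_order:
  assumes "finite (pverts G)"
  shows "staller_start_burning_number G \<le> card (pverts G)"
  unfolding staller_start_burning_number_def
  using rounds_left_le_card[OF assms, of Staller "{}"] by simp

text \<open>If Staller's first vertex \<open>v\<close> has a neighbor, the fire spreads in round 2.
  Otherwise Burner selects \<open>a\<close>, and \<open>b\<close> catches fire in round 3. Either
  way one vertex burns without a selection.\<close>

lemma (in pair_graph) staller_start_le_edge:
  assumes "(a, b) \<in> parcs G" "card (pverts G) \<ge> 4"
  shows "staller_start_burning_number G \<le> card (pverts G) - 1"
proof -
  have ab: "a \<in> pverts G" "b \<in> pverts G" "a \<noteq> b"
    using assms(1) in_arcsD1 in_arcsD2 no_loops by fastforce+
  have fin: "finite (pverts G)"
    by (rule pair_finite_verts)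
  have few: "card (pverts G - spread G B) \<le> card (pverts G) - card A"
    if "A \<subseteq> spread G B" "A \<subseteq> pverts G" for A B
  proof -
    have "card (pverts G - spread G B) \<le> card (pverts G - A)"
      using fin that by (intro card_mono) auto
    also have "\<dots> = card (pverts G) - card A"
      using fin that by (intro card_Diff_subset) (auto intro: finite_subset)
    finally show ?thesis .
  qed
  have "rounds_left G Burner {v} \<le> card (pverts G) - 2" if v: "v \<in> pverts G" for v
  proof (cases "spread G {v} = {v}")
    case False
    then obtain w where w: "w \<in> spread G {v}" "w \<noteq> v"
      using subset_spread[of "{v}" G] by blast
    then have "card (pverts G - spread G {v}) \<le> card (pverts G) - card {v, w}"
      using v subset_spread[of "{v}" G] spread_subset[of "{v}" G] by (intro few) auto
    then show ?thesis
      using rounds_left_le_card_spread[OF fin, of Burner "{v}"] assms(2) w(2) by simp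
  next
    case True
    have "(b, a) \<in> parcs G"
      using assms(1) pair_sym_arcs by (auto simp: symmetric_def sym_def)
    \<comment> \<open>As \<open>v\<close> is isolated, it is neither end of the edge; both
      directions of the arc are used.\<close>
    then have ne: "a \<noteq> v" "b \<noteq> v"
      using True assms(1) ab by (auto simp: spread_def set_eq_iff)
    have "card (pverts G - spread G {a, v}) \<le> card (pverts G) - card {a, b, v}"
      using ab v assms(1) by (intro few) (auto simp: spread_def)
    \<comment> \<open>With at least 4 vertices the order minus 3 is at least 1, which absorbs the
      \<open>max 1\<close>.\<close>
    then have "rounds_left G Staller (insert a (spread G {v})) \<le> card (pverts G) - 3"
      using rounds_left_le_card_spread[OF fin, of Staller "{a, v}"] assms(2) ab ne True by simp
    then show ?thesis
      using rounds_left_Burner_le[of a G "{v}" "card (pverts G) - 3"] True ab ne assms(2) by auto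
  qed
  then show ?thesis
    using staller_start_le_SucI[of G "card (pverts G) - 2"] assms(2) by force
qed

lemma (in pair_graph) staller_start_sum_le_disconnected:
  assumes "\<not> spread_connected G"
  shows "staller_start_burning_number G + staller_start_burning_number (complement G)
      \<le> card (pverts G) + 2"
proof -
  let ?H = "complement G"
  have fin: "finite (pverts G)"
    by (rule pair_finite_verts)
  have dist2: "pverts ?H \<subseteq> spread ?H (spread ?H {v})" if "v \<in> pverts G" for v
    using spread_spread_complement[OF assms that] by simp
  \<comment> \<open>A nonempty set closed under spreading contains the two-step spread of each of
    its vertices, which is everything.\<close>
  have "spread_connected ?H"
    unfolding spread_connected_def
  proof (intro allI impI)
    fix B assume B: "B \<subseteq> pverts ?H \<and> B \<noteq> {} \<and> spread ?H B = B"
    then obtain v where v: "v \<in> B" by blast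
    have "spread ?H (spread ?H {v}) \<subseteq> spread ?H (spread ?H B)"
      using v by (intro spread_mono) auto
    then show "B = pverts ?H"
      using B v dist2[of v] by auto
  qed
  then have half: "staller_start_burning_number ?H \<le> Suc (card (pverts G) div 2)"
    using staller_start_le_spread_connected[of ?H] fin by simp
  have three: "staller_start_burning_number ?H \<le> 3"
    using staller_start_le_SucI[of ?H 2] rounds_left_le_2[OF dist2] by simp
  show ?thesis
  proof (cases "staller_start_burning_number ?H \<le> 2")
    case True
    then show ?thesis
      using staller_start_le_order[OF fin] by simp
  next
    case False
    \<comment> \<open>A value of at least 3 forces \<open>card (pverts G) div 2\<close> to be at
      least 2.\<close>
    have "card (pverts G) \<ge> 4"
      using half False by linarith
    \<comment> \<open>If \<open>G\<close> had no edge, its complement would be complete and burn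
      entirely in round 2.\<close>
    moreover have "\<exists>a b. (a, b) \<in> parcs G"
    proof (rule ccontr)
      assume "\<not> ?thesis"
      then have "rounds_left ?H Burner {v} \<le> 1" if "v \<in> pverts G" for v
        using that by (intro rounds_left_le_1) (auto simp: spread_def complement_def)
      then show False
        using staller_start_le_SucI[of ?H 1] False by simp
    qed
    ultimately show ?thesis
      using staller_start_le_edge three by fastforce
  qed
qed

theorem theorem13:
  fixes G :: "'a pair_pre_digraph" and n :: nat
  assumes "pair_graph G"
    and "card (pverts G) = n"
    and "n \<ge> 2"
  shows "4 \<le> staller_start_burning_number G + staller_start_burning_number (complement G)
       \<and> staller_start_burning_number G + staller_start_burning_number (complement G) \<le> n + 2"
proof
  interpret G: pair_graph G by fact
  interpret H: pair_graph "complement G" by (rule G.pair_graph_complement)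
  show "4 \<le> staller_start_burning_number G + staller_start_burning_number (complement G)"
    using two_le_staller_start[of G] two_le_staller_start[of "complement G"] assms by simp
  consider "\<not> spread_connected G" | "\<not> spread_connected (complement G)"
    | "spread_connected G" "spread_connected (complement G)" by blast
  then show "staller_start_burning_number G + staller_start_burning_number (complement G) \<le> n + 2"
  proof cases
    case 1
    then show ?thesis
      using G.staller_start_sum_le_disconnected assms(2) by simp
  next
    \<comment> \<open>The disconnected case applied to the complement, whose own complement is
      \<open>G\<close>.\<close>
    case 2
    then show ?thesis
      using H.staller_start_sum_le_disconnected assms(2) by (simp add: G.complement_complement)
  next
    \<comment> \<open>Twice \<open>Suc (n div 2)\<close> is at most \<open>n + 2\<close>.\<close>
    case 3
    then show ?thesis
      using staller_start_le_spread_connected[of G]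
        staller_start_le_spread_connected[of "complement G"] assms(2) G.pair_finite_verts
      by simp
  qed
qed

end
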